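(* For $x\in(-1/e,0)$ define $$\beta_0(x)=\frac{ex\ln\left(1+\sqrt{1+ex}\right)}{\sqrt{1+ex}\,\left(1+\sqrt{1+ex}\right)},\qquad \beta_{n+1}(x)=\frac{\beta_n(x)}{1+\beta_n(x)}\left(1+\ln\left(\frac{x}{\beta_n(x)}\right)\right)\quad(n\in\mathbb{N}).$$ Then for every integer $n\ge1$ and every $x\in(-1/e,0)$, $$0<\beta_n(x)-\mathrm{W}_0(x)<\left(\frac1{10}\right)^{2^n}.$$
   Context: $\mathbb{N}=\{0,1,2,\ldots\}$. $\mathrm{W}_0:[-1/e,\infty)\to[-1,\infty)$ is the principal real branch of the Lambert function: $\mathrm{W}_0(x)$ is the unique $w\ge -1$ with $we^w=x$. *)

theory Defs
  imports Complex_Main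
begin

(* Principal real branch of the Lambert function; meaningful only for x >= -1/e,
   see lambert_W0_ex1. *)
definition lambert_W0 :: "real \<Rightarrow> real" where
  "lambert_W0 x = (THE w. w \<ge> -1 \<and> w * exp w = x)"

lemma mult_exp_strict_mono:
  fixes v w :: real
  assumes "-1 \<le> v" "v < w"
  shows "v * exp v < w * exp w"
proof (rule DERIV_pos_imp_increasing_open[OF assms(2)])
  fix t :: real assume "v < t" "t < w"
  then have "(1 + t) * exp t > 0" using assms(1) by simp
  moreover have "((\<lambda>t. t * exp t) has_real_derivative (1 + t) * exp t) (at t)"
    by (auto intro!: derivative_eq_intros simp: algebra_simps)
  ultimately show "\<exists>y. ((\<lambda>t. t * exp t) has_real_derivative y) (at t) \<and> y > 0" by blast
qed (auto intro!: continuous_intros)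

lemma lambert_W0_ex1:
  fixes x :: real
  assumes "-1 / exp 1 \<le> x"
  shows "\<exists>!w. w \<ge> -1 \<and> w * exp w = x"
proof -
  have "\<exists>w\<ge>-1. w \<le> max 0 x \<and> w * exp w = x"
  proof (rule IVT')
    show "(-1) * exp (-1) \<le> x" using assms by (simp add: exp_minus divide_inverse)
    show "x \<le> max 0 x * exp (max 0 x)"
      by (auto simp: max_def mult_le_cancel_left1)
  qed (auto intro!: continuous_intros)
  then obtain w where w: "w \<ge> -1" "w * exp w = x" by blast
  show ?thesis
  proof (rule ex1I[of _ w])
    fix v assume "v \<ge> -1 \<and> v * exp v = x"
    then show "v = w"
      using w mult_exp_strict_mono[of v w] mult_exp_strict_mono[of w v]
      by (cases v w rule: linorder_cases) auto
  qed (use w in blast)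
qed

lemma lambert_W0:
  assumes "-1 / exp 1 \<le> x"
  shows "lambert_W0 x \<ge> -1" "lambert_W0 x * exp (lambert_W0 x) = x"
  using theI'[OF lambert_W0_ex1[OF assms]] unfolding lambert_W0_def by auto

(* Intended for -1/e < x < 0. *)
primrec beta :: "nat \<Rightarrow> real \<Rightarrow> real" where
  "beta 0 x = exp 1 * x * ln (1 + sqrt (1 + exp 1 * x)) /
     (sqrt (1 + exp 1 * x) * (1 + sqrt (1 + exp 1 * x)))"
| "beta (Suc n) x = beta n x / (1 + beta n x) * (1 + ln (x / beta n x))"

end

theory Submission
  imports Defs
begin

text \<open>
  Put \<open>w = W\<^sub>0(x)\<close>. The recursion is Newton's method for \<open>b \<mapsto> ln (x / b) - b\<close>, and with
  \<open>t = w / b - 1\<close> one has \<open>\<beta>\<^sub>n\<^sub>+\<^sub>1 - w = -b (t - ln (1 + t)) / (1 + b)\<close> for \<open>b = \<beta>\<^sub>n\<close>.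
  Hence the error stays positive and is at most \<open>(b - w)\<^sup>2 / (2 \<bar>b\<bar> (1 + b))\<close>, so the
  quotient of the error and \<open>M = 2 \<bar>\<beta>\<^sub>0\<bar> (1 + w) \<le> 1\<close> is at least squared in each step.
  It remains to see \<open>0 < \<beta>\<^sub>0 - w < M / 10\<close>. With \<open>s = sqrt (1 + e x)\<close> and
  \<open>u = ln (1 + s) / s\<close> one has \<open>\<beta>\<^sub>0 = -(1 - s) u\<close>; comparing values of the increasing function
  \<open>v \<mapsto> v e\<^sup>v\<close>, the lower bound becomes \<open>ln u < u - 1\<close>, and the upper bound follows from
  rational estimates of the logarithm.
\<close>

text \<open>The left side is the [1/1] Pade approximant of \<open>ln (1 + r)\<close> at 0. Both
  sides vanish at 0 and the derivative of the difference is a square over a positive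
  product.\<close>

lemma ln_one_plus_ge_pade:
  fixes r :: real
  assumes "r \<ge> 0"
  shows "2 * r / (2 + r) \<le> ln (1 + r)"
proof -
  have "(\<lambda>r. ln (1 + r) - 2 * r / (2 + r)) 0 \<le> (\<lambda>r. ln (1 + r) - 2 * r / (2 + r)) r"
  proof (rule DERIV_nonneg_imp_nondecreasing[OF assms])
    fix y :: real assume y: "0 \<le> y" "y \<le> r"
    have "((\<lambda>r. ln (1 + r) - 2 * r / (2 + r)) has_real_derivative
        1 / (1 + y) - (2 * (2 + y) - 2 * y) / ((2 + y) * (2 + y))) (at y)"
      using y by (auto intro!: derivative_eq_intros)
    moreover have "1 / (1 + y) - (2 * (2 + y) - 2 * y) / ((2 + y) * (2 + y))
        = y^2 / ((1 + y) * (2 + y)^2)"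
      using y by (simp add: divide_simps) algebra
    ultimately show "\<exists>d. ((\<lambda>r. ln (1 + r) - 2 * r / (2 + r)) has_real_derivative d) (at y) \<and> d \<ge> 0"
      using y by auto
  qed
  then show ?thesis by simp
qed

text \<open>Both sides agree to second order at 1, so no precision is lost there up to cubic
  terms.\<close>

lemma ln_ge_half_diff_inverse:
  fixes u :: real
  assumes "0 < u" "u \<le> 1"
  shows "(u - 1 / u) / 2 \<le> ln u"
proof -
  have "(\<lambda>u. ln u - (u - 1 / u) / 2) 1 \<le> (\<lambda>u. ln u - (u - 1 / u) / 2) u"
  proof (rule DERIV_nonpos_imp_nonincreasing[OF assms(2)])
    fix y :: real assume y: "u \<le> y" "y \<le> 1"
    then have y0: "y > 0" using assms by simp
    have "((\<lambda>u. ln u - (u - 1 / u) / 2) has_real_derivative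
        1 / y - (1 + 1 / (y * y)) / 2) (at y)"
      using y0 by (auto intro!: derivative_eq_intros)
    moreover have "1 / y - (1 + 1 / (y * y)) / 2 = - ((1 - y)^2 / (2 * y^2))"
      using y0 by (simp add: divide_simps) algebra
    moreover have "- ((1 - y)^2 / (2 * y^2)) \<le> 0" by simp
    ultimately show "\<exists>d. ((\<lambda>u. ln u - (u - 1 / u) / 2) has_real_derivative d) (at y) \<and> d \<le> 0"
      by metis
  qed
  then show ?thesis by simp
qed

lemma ln_less_minus_one:
  fixes u :: real
  assumes "0 < u" "u \<noteq> 1"
  shows "ln u < u - 1"
  using assms ln_le_minus_one[of u] ln_eq_minus_one[of u] by linarith

lemma less_iff_mult_exp_less:
  fixes v w :: real
  assumes "-1 \<le> v" "-1 \<le> w"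
  shows "v < w \<longleftrightarrow> v * exp v < w * exp w"
  using assms mult_exp_strict_mono[of v w] mult_exp_strict_mono[of w v]
  by (cases v w rule: linorder_cases) auto

lemma newton_step_bounds:
  fixes w b :: real
  assumes "-1 < w" "w < b" "b < 0"
  defines "b' \<equiv> b / (1 + b) * (1 + ln (w * exp w / b))"
  shows "w < b'" "b' - w \<le> (b - w)^2 / (2 * - b * (1 + w))"
proof -
  define t where "t = w / b - 1"
  have wt: "w = b * (1 + t)" using assms by (simp add: t_def)
  have t: "t > 0" using assms by (simp add: t_def field_simps)
  have "w * exp w / b = (1 + t) * exp w" using assms(3) by (simp add: t_def)
  then have ln: "ln (w * exp w / b) = ln (1 + t) + w" using t by (simp add: ln_mult)
  have *: "b' - w = - b * (t - ln (1 + t)) / (1 + b)"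
    unfolding b'_def ln using assms(1-3) by (simp add: wt field_simps)
  have "ln (1 + t) < t" using t ln_less_minus_one[of "1 + t"] by simp
  then have "- b * (t - ln (1 + t)) / (1 + b) > 0"
    using assms(1-3) by (intro divide_pos_pos mult_pos_pos) auto
  then show "w < b'" using * by simp
  have "t - ln (1 + t) \<le> t - 2 * t / (2 + t)" using ln_one_plus_ge_pade[of t] t by simp
  also have "\<dots> = t^2 / (2 + t)" using t by (simp add: field_simps power2_eq_square)
  also have "\<dots> \<le> t^2 / 2" using t by (intro divide_left_mono) auto
  finally have le: "t - ln (1 + t) \<le> t^2 / 2" .
  have "b' - w \<le> - b * (t^2 / 2) / (1 + b)"
    unfolding * using assms(1-3) le by (intro divide_right_mono mult_left_mono) auto
  \<comment> \<open>Replacing \<open>1 + b\<close> by the smaller \<open>1 + w\<close> makes this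
    factor the same for all iterates.\<close>
  also have "\<dots> \<le> - b * (t^2 / 2) / (1 + w)"
    using assms(1-3) by (intro divide_left_mono mult_nonneg_nonneg) auto
  also have "\<dots> = (b - w)^2 / (2 * - b * (1 + w))"
  proof -
    have "(b - w)^2 = b^2 * t^2" by (simp add: wt power2_eq_square algebra_simps)
    then show ?thesis using assms(3) by (simp add: power2_eq_square)
  qed
  finally show "b' - w \<le> (b - w)^2 / (2 * - b * (1 + w))" .
qed

text \<open>With \<open>B\<close> the negated starting value and \<open>V = 6 * B / (5 + B)\<close>,
  this is the logarithmic form of \<open>- V * exp (- V) < x\<close>. In terms of
  \<open>d = 1 - B\<close> the linear terms cancel, and what remains is at least
  \<open>11 * d^2 / 72 - s^2 / 8\<close>, positive because \<open>s < d\<close>.\<close>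

lemma initial_ln_bound:
  fixes s u :: real
  assumes "0 < s" "s < 1" "2 / (2 + s) \<le> u" "u < 1"
  defines "B \<equiv> (1 - s) * u"
  shows "ln u + ln (6 / (5 + B)) - 6 * B / (5 + B) + 1 - s * u > 0"
proof -
  have "2 / (2 + s) > 0" using assms(1) by simp
  then have u0: "u > 0" using assms(3) by linarith
  define d where "d = 1 - B"
  have B0: "B > 0" using assms u0 by (simp add: B_def)
  have "B < (1 - s) * 1" unfolding B_def using assms by (intro mult_strict_left_mono) auto
  then have ds: "d > s" by (simp add: d_def)
  have d1: "d < 1" using B0 by (simp add: d_def)
  have d0: "d > 0" using ds assms by simp
  define r where "r = d / (6 - d)"
  have r: "r > 0" using d0 d1 by (simp add: r_def)
  have "6 / (5 + B) = 1 + r" using d1 by (simp add: r_def d_def field_simps)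
  then have l1: "ln (6 / (5 + B)) \<ge> 2 * r / (2 + r)" using ln_one_plus_ge_pade[of r] r by simp
  have "2 * r / (2 + r) = 2 * d / (12 - d)"
  proof -
    have "2 + r = (12 - d) / (6 - d)" using d1 by (simp add: r_def field_simps)
    then show ?thesis using d1 by (simp add: r_def)
  qed
  moreover have "1 - 6 * B / (5 + B) = 5 * d / (6 - d)" using d1 by (simp add: d_def field_simps)
  moreover have "2 * d / (12 - d) - 2 * d / 12 = d^2 / (6 * (12 - d))"
    using d1 by (simp add: field_simps power2_eq_square)
  moreover have "d^2 / (6 * (12 - d)) \<ge> d^2 / (6 * 12)"
    using d1 d0 by (intro divide_left_mono) auto
  moreover have "5 * d / (6 - d) - 5 * d / 6 = 5 * d^2 / (6 * (6 - d))"
    using d1 by (simp add: field_simps power2_eq_square)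
  moreover have "5 * d^2 / (6 * (6 - d)) \<ge> 5 * d^2 / (6 * 6)"
    using d1 d0 by (intro divide_left_mono) auto
  \<comment> \<open>The linear parts \<open>d / 6\<close> and \<open>5 * d / 6\<close> add up to
    \<open>d\<close>, the quadratic coefficients \<open>1 / 72\<close> and \<open>5 / 36\<close> to
    \<open>11 / 72\<close>.\<close>
  ultimately have h: "ln (6 / (5 + B)) + (1 - 6 * B / (5 + B)) \<ge> d + 11 * d^2 / 72"
    using l1 by linarith
  have "ln u \<ge> (u - 1 / u) / 2" using ln_ge_half_diff_inverse u0 assms by simp
  moreover have "(u - 1 / u) / 2 = u - 1 - (1 - u)^2 / (2 * u)"
    using u0 by (simp add: field_simps power2_eq_square)
  moreover have "(1 - u)^2 / (2 * u) \<le> s^2 / 8"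
  proof -
    \<comment> \<open>The factor \<open>u\<close> is kept in one of the two bounds on
      \<open>1 - u\<close>, to cancel the \<open>u\<close> in the denominator.\<close>
    have a: "1 - u \<le> u * s / 2" using assms(1,3) by (simp add: field_simps)
    also have "u * s / 2 \<le> s / 2" using assms by (simp add: mult_left_le_one_le u0 less_imp_le)
    finally have b: "1 - u \<le> s / 2" .
    have "(1 - u)^2 \<le> (u * s / 2) * (s / 2)"
      unfolding power2_eq_square using a b assms u0 by (intro mult_mono) auto
    then show ?thesis using u0 by (simp add: field_simps power2_eq_square)
  qed
  moreover have "s * u = u - B" by (simp add: B_def algebra_simps)
  moreover have "s^2 < d^2" using ds assms by (intro power_strict_mono) auto
  moreover have "s^2 > 0" using assms by simp
  ultimately show ?thesis using h d_def by linarith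
qed

lemma beta_0_bounds:
  fixes x :: real
  assumes "-1 / exp 1 < x" "x < 0"
  defines "w \<equiv> lambert_W0 x"
  shows "-1 < w" "w < beta 0 x" "beta 0 x < 0"
    "beta 0 x - w < 2 * - beta 0 x * (1 + w) / 10"
proof -
  have w: "w \<ge> -1" "w * exp w = x" using lambert_W0[of x] assms by (auto simp: w_def)
  have "w \<noteq> -1" using w assms(1) by (auto simp: exp_minus divide_inverse)
  then show w1: "-1 < w" using w by simp
  define s where "s = sqrt (1 + exp 1 * x)"
  have ex: "exp 1 * x > -1" using assms(1) by (simp add: field_simps)
  have s: "0 < s" "s < 1" using ex assms(2) by (auto simp: s_def mult_pos_neg)
  have "s^2 = 1 + exp 1 * x" using ex by (simp add: s_def)
  then have xs: "exp 1 * x = - ((1 - s) * (1 + s))" by (simp add: algebra_simps power2_eq_square)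
  have xs': "x = - exp (ln (1 - s) + ln (1 + s) - 1)"
    using s xs by (simp add: exp_add exp_diff field_simps)
  define u where "u = ln (1 + s) / s"
  define B where "B = (1 - s) * u"
  have lnu: "ln (1 + s) = s * u" using s by (simp add: u_def)
  have b0: "beta 0 x = - B"
  proof -
    have "exp 1 * x * ln (1 + s) / (s * (1 + s)) = - ((1 - s) * (ln (1 + s) / s))"
      unfolding xs using s by simp
    then show ?thesis unfolding B_def u_def s_def by simp
  qed
  have u1: "2 / (2 + s) \<le> u"
    using ln_one_plus_ge_pade[of s] s by (simp add: u_def field_simps)
  have u0: "u > 0" using s by (simp add: u_def)
  have "ln (1 + s) < s"
    using s ln_less_minus_one[of "1 + s"] by simp
  then have u2: "u < 1" using s by (simp add: u_def)
  have B0: "B > 0" using s u0 by (simp add: B_def)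
  then show "beta 0 x < 0" using b0 by simp
  have "B < 1 * 1" unfolding B_def using s u0 u2 by (intro mult_strict_mono) auto
  then have B1: "B < 1" by simp
  have lnB: "ln B = ln (1 - s) + ln u" using s u0 by (simp add: B_def ln_mult)
  \<comment> \<open>Since \<open>xs'\<close> also has the shape \<open>- exp _\<close>, both
    comparisons with \<open>x\<close> reduce to comparing exponents.\<close>
  have val: "- v * exp (- v) = - exp (ln v - v)" if "v > 0" for v :: real
    using that by (simp add: exp_diff exp_minus field_simps)
  have "ln u < u - 1" using u0 u2 ln_less_minus_one by simp
  moreover have "B = u - s * u" by (simp add: B_def algebra_simps)
  ultimately have "w * exp w < - B * exp (- B)"
    unfolding w(2) val[OF B0] xs' lnB lnu by simp
  then show "w < beta 0 x"
    unfolding b0 using less_iff_mult_exp_less[of w "- B"] w1 B1 by simp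
  \<comment> \<open>\<open>- V\<close> is the value of \<open>w\<close> at which the claimed upper
    bound would be an equality, so the claim is equivalent to \<open>- V < w\<close>.\<close>
  define V where "V = 6 * B / (5 + B)"
  have V0: "V > 0" using B0 by (simp add: V_def)
  have V1: "V < 1" using B0 B1 by (simp add: V_def field_simps)
  have "ln V = ln B + ln (6 / (5 + B))"
    using B0 by (simp add: V_def ln_mult ln_div)
  moreover have "ln u + ln (6 / (5 + B)) - 6 * B / (5 + B) + 1 - s * u > 0"
    using initial_ln_bound[OF s u1 u2] by (simp add: B_def)
  ultimately have "- V * exp (- V) < w * exp w"
    unfolding w(2) val[OF V0] xs' lnu using lnB by (simp add: V_def)
  then have "- V < w" using less_iff_mult_exp_less[of "- V" w] w1 V1 by simp
  then have "- (6 * B) < w * (5 + B)" using B0 by (simp add: V_def field_simps)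
  then show "beta 0 x - w < 2 * - beta 0 x * (1 + w) / 10"
    unfolding b0 by (simp add: field_simps)
qed

theorem theorem4p17:
  fixes n :: nat and x :: real
  assumes "n \<ge> 1" and "-1 / exp 1 < x" and "x < 0"
  shows "0 < beta n x - lambert_W0 x \<and> beta n x - lambert_W0 x < (1 / 10) ^ (2 ^ n)"
proof -
  define w where "w = lambert_W0 x"
  define M where "M = 2 * - beta 0 x * (1 + w)"
  note init = beta_0_bounds[OF assms(2,3), folded w_def]
  have w: "w * exp w = x" using lambert_W0(2)[of x] assms by (simp add: w_def)
  have M0: "M > 0" unfolding M_def using init(1,3) by (intro mult_pos_pos) auto
  have "M \<le> 2 * - w * (1 + w)" unfolding M_def using init by (intro mult_right_mono) auto
  also have "\<dots> = 1 / 2 - (1 + 2 * w)^2 / 2" by (simp add: field_simps power2_eq_square)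
  also have "\<dots> \<le> 1" by (rule order_trans[of _ "1 / 2"]) simp_all
  finally have M1: "M \<le> 1" .
  \<comment> \<open>The middle conjunct lets \<open>- b\<close> in the Newton estimate be replaced
    by \<open>- beta 0 x\<close>, which gives the fixed denominator \<open>M\<close>.\<close>
  have "w < beta n x \<and> beta n x \<le> beta 0 x \<and> beta n x - w < M * (1 / 10) ^ (2 ^ n)"
  proof (induction n)
    case 0
    then show ?case using init by (simp add: M_def)
  next
    case (Suc n)
    define b q where "b = beta n x" and "q = (1 / 10 :: real) ^ (2 ^ n)"
    have b: "w < b" "b \<le> beta 0 x" "b < 0" "b - w < M * q"
      using Suc init by (auto simp: b_def q_def)
    have q: "0 < q" "q \<le> 1" by (auto simp: q_def power_le_one)
    have *: "w < beta (Suc n) x" "beta (Suc n) x - w \<le> (b - w)^2 / (2 * - b * (1 + w))"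
      using newton_step_bounds[OF init(1) b(1,3)] by (simp_all add: w b_def)
    note *(2)
    also have "(b - w)^2 / (2 * - b * (1 + w)) \<le> (b - w)^2 / M"
      using b init M0 unfolding M_def
      by (intro divide_left_mono mult_right_mono mult_pos_pos) auto
    finally have le: "beta (Suc n) x - w \<le> (b - w)^2 / M" .
    have "(b - w)^2 / M < (M * q)^2 / M"
      using b M0 by (intro divide_strict_right_mono power_strict_mono) auto
    also have "\<dots> = M * q^2" using M0 by (simp add: power2_eq_square)
    also have "q^2 = (1 / 10) ^ (2 ^ Suc n)" by (simp add: q_def power_mult[symmetric] mult.commute)
    finally have "beta (Suc n) x - w < M * (1 / 10) ^ (2 ^ Suc n)" using le by simp
    \<comment> \<open>The new error does not exceed the old one, so the iterates stay below
      \<open>beta 0 x\<close>.\<close>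
    moreover have "(b - w)^2 / M \<le> b - w"
    proof -
      have "b - w \<le> M" using b(4) mult_left_le[of q M] M0 q by linarith
      then have "(b - w) * (b - w) \<le> (b - w) * M" using b by (intro mult_left_mono) auto
      then show ?thesis using M0 by (simp add: field_simps power2_eq_square)
    qed
    ultimately show ?case using *(1) le b by simp
  qed
  moreover have "M * (1 / 10) ^ (2 ^ n) \<le> (1 / 10) ^ (2 ^ n)"
    using M1 by (simp add: mult_left_le_one_le M0 less_imp_le)
  ultimately show ?thesis unfolding w_def by linarith
qed

end
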